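(* For any fixed integer $r\ge 1$, $$\sum_{n\le x}\overline{c}_r(n)=x+O(1),$$ where $x\ge 1$ is real, $n$ runs through the integers from $1$ to $\lfloor x\rfloor$, and the implied constant may depend on $r$.
   Context: An integer $a$ is regular (mod $r$) if there is an integer $x$ with $a^2x\equiv a \pmod r$. Define $$\overline{c}_r(n)=\sum_{\substack{a \pmod r\\ a\text{ regular}\pmod r}}\exp(2\pi i a n/r),$$ the sum being over the regular elements $a$ of a complete residue system mod $r$ (e.g. $1\le a\le r$). *)

theory Defs
  imports "HOL-Analysis.Analysis" "HOL-Number_Theory.Cong"
begin

definition regular_mod :: "int \<Rightarrow> int \<Rightarrow> bool" where
  "regular_mod r a \<longleftrightarrow> (\<exists>x::int. [a\<^sup>2 * x = a] (mod r))"

definition cbar :: "int \<Rightarrow> int \<Rightarrow> complex" where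
  "cbar r n = (\<Sum>a | a \<in> {1..r} \<and> regular_mod r a.
     exp (2 * of_real pi * \<i> * of_int a * of_int n / of_int r))"

end

theory Submission
  imports Defs
begin

text \<open>Interchanging the two sums, the residue \<open>a = r\<close>, which is always regular, contributes
  \<open>\<lfloor>x\<rfloor>\<close>, while every other residue contributes a geometric sum with ratio a nontrivial root of unity,
  which is bounded independently of \<open>x\<close>.\<close>

text \<open>The geometric sum telescopes to \<open>(z - z ^ Suc m) / (1 - z)\<close>, whose
  numerator has norm at most 2 for every \<open>m\<close>; for \<open>m = 0\<close> the sum is
  empty.\<close>

lemma norm_sum_power_le:
  fixes z :: "'a::real_normed_field"
  assumes "norm z = 1" "z \<noteq> 1"
  shows "norm (\<Sum>k = 1..m. z ^ k) \<le> 2 / norm (1 - z)"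
proof (cases "m < 1")
  case False
  have "norm (z ^ 1 - z ^ Suc m) \<le> norm (z ^ 1) + norm (z ^ Suc m)"
    by (rule norm_triangle_ineq4)
  also have "\<dots> = 2"
    using assms by (simp add: norm_power norm_mult)
  finally show ?thesis
    using False assms by (simp add: sum_gp norm_divide divide_right_mono)
qed auto

lemma exp_root_of_unity_neq_1:
  fixes a r :: int
  assumes "0 < a" "a < r"
  shows "exp (2 * of_real pi * \<i> * of_int a / of_int r) \<noteq> (1::complex)"
proof
  assume "exp (2 * of_real pi * \<i> * of_int a / of_int r) = (1::complex)"
  \<comment> \<open>With the exponent written as \<open>\<i>\<close> times a real number, its
    imaginary part can be read off and must be a multiple of \<open>2 * pi\<close>, which forces
    \<open>r dvd a\<close>.\<close>
  moreover have "2 * of_real pi * \<i> * of_int a / of_int r =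
      \<i> * complex_of_real (2 * pi * of_int a / of_int r)"
    by simp
  ultimately obtain n :: int where "2 * pi * of_int a / of_int r = of_int (2 * n) * pi"
    unfolding exp_eq_1 by (metis Im_i_times Re_complex_of_real)
  then have "real_of_int a = of_int (n * r)"
    using assms by (simp add: field_simps)
  then have "r dvd a"
    by (metis dvd_triv_right of_int_eq_iff)
  then show False
    using assms zdvd_not_zless by blast
qed

theorem theorem6p1:
  fixes r :: int
  assumes "r \<ge> 1"
  shows "\<exists>C::real. \<forall>x::real. x \<ge> 1 \<longrightarrow>
           norm ((\<Sum>n = 1..\<lfloor>x\<rfloor>. cbar r n) - complex_of_real x) \<le> C"
proof -
  define w where "w a = exp (2 * of_real pi * \<i> * of_int a / of_int r :: complex)" for a :: int
  define S where "S = {a \<in> {1..r}. regular_mod r a}"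
  have "finite S"
    unfolding S_def by (rule finite_Collect_conjI) simp
  \<comment> \<open>Both sides of the congruence vanish mod \<open>r\<close>, so any witness
    works.\<close>
  have "r \<in> S"
    using assms by (auto simp: S_def regular_mod_def cong_def)
  have w_r: "w r = 1"
    using assms by (simp add: w_def)
  have norm_w: "norm (w a) = 1" for a
    by (simp add: w_def norm_exp_eq_Re)
  have w_neq_1: "w a \<noteq> 1" if "a \<in> S - {r}" for a
    unfolding w_def using that by (intro exp_root_of_unity_neq_1) (auto simp: S_def)
  have cbar_eq: "cbar r (int k) = (\<Sum>a\<in>S. w a ^ k)" for k
    by (simp add: cbar_def S_def w_def exp_of_nat_mult[symmetric] mult_ac)
  \<comment> \<open>\<open>D\<close> depends on \<open>r\<close> only; the extra 1 in the bound
    \<open>D + 1\<close> below absorbs the fractional part of \<open>x\<close>.\<close>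
  define D where "D = (\<Sum>a\<in>S - {r}. 2 / norm (1 - w a))"
  have "norm ((\<Sum>n = 1..\<lfloor>x\<rfloor>. cbar r n) - complex_of_real x) \<le> D + 1" if "x \<ge> 1" for x :: real
  proof -
    define m where "m = nat \<lfloor>x\<rfloor>"
    have m: "\<lfloor>x\<rfloor> = int m"
      using that by (simp add: m_def)
    \<comment> \<open>Passing to natural indices turns the exponentials into powers of
      \<open>w a\<close>.\<close>
    have "(\<Sum>n = 1..\<lfloor>x\<rfloor>. cbar r n) = (\<Sum>k = 1..m. cbar r (int k))"
      unfolding m using image_int_atLeastAtMost[of 1 m]
      by (metis (no_types, lifting) inj_on_of_nat int_ops(2) sum.reindex_cong)
    also have "\<dots> = (\<Sum>a\<in>S. \<Sum>k = 1..m. w a ^ k)"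
      unfolding cbar_eq by (rule sum.swap)
    \<comment> \<open>Since \<open>w r = 1\<close>, the residue \<open>r\<close> contributes
      \<open>m\<close> ones, which is the main term.\<close>
    also have "\<dots> = of_nat m + (\<Sum>a\<in>S - {r}. \<Sum>k = 1..m. w a ^ k)"
      using \<open>finite S\<close> \<open>r \<in> S\<close> by (simp add: sum.remove w_r)
    finally have "(\<Sum>n = 1..\<lfloor>x\<rfloor>. cbar r n) - complex_of_real x =
        (\<Sum>a\<in>S - {r}. \<Sum>k = 1..m. w a ^ k) + complex_of_real (real m - x)"
      by simp
    moreover have "norm (\<Sum>a\<in>S - {r}. \<Sum>k = 1..m. w a ^ k) \<le> D"
      unfolding D_def by (intro sum_norm_le norm_sum_power_le norm_w w_neq_1)
    moreover have "norm (complex_of_real (real m - x)) \<le> 1"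
      unfolding norm_of_real using m by linarith
    ultimately show ?thesis
      by (metis norm_triangle_mono)
  qed
  then show ?thesis
    by blast
qed

end
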